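(* Suppose that $s>0$ and that $X=(X,d,\mathcal{H}^s)$ is an Ahlfors $s$-regular Lipschitz differentiability space containing a chart $U$ of dimension $k$, with $k<s$. Then $U$ is strongly $s$-unrectifiable, i.e. $\mathcal{H}^s(f(U))=0$ for every $N\in\mathbb{N}$ and every Lipschitz map $f\colon U\to\mathbb{R}^N$.
   Context: $\mathcal{H}^s$ denotes $s$-dimensional Hausdorff measure; $\overline{B}(x,r)$ is the closed ball. A metric space $X$ is Ahlfors $s$-regular if there is $C>0$ with $C^{-1}r^s\le \mathcal{H}^s(\overline{B}(x,r))\le Cr^s$ for all $x\in X$ and $r\le \operatorname{diam}X$. An Ahlfors $s$-regular Lipschitz differentiability space is equipped with the measure $\mathcal{H}^s$. A Lipschitz differentiability space is a metric measure space $(X,d,\mu)$ ($\mu$ Borel regular) for which there are positive measure sets $U_i$ (charts) covering $X$, positive integers $n_i$ (dimensions of the charts), and Lipschitz maps $\phi_i\colon U_i\to\mathbb{R}^{n_i}$ such that for every Lipschitz $f\colon X\to\mathbb{R}$ and every $i$, for $\mu$-almost every $x\in U_i$ there is a unique $df_x\in\mathbb{R}^{n_i}$ with $$\lim_{y\to x}\frac{|f(y)-f(x)-df_x\cdot(\phi_i(y)-\phi_i(x))|}{d(x,y)}=0$$ (with $y$ ranging over $U_i$, and $\cdot$ the standard scalar product). *)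

theory Defs
  imports "HOL-Analysis.Analysis"
begin

text \<open>
  Metric spaces are elements of the library type \<^typ>\<open>'a metric\<close>, because charts of one space may
  have different dimensions, so that \<open>\<real>\<^sup>n\<close> is needed with a variable \<open>n :: nat\<close>. A point of \<open>\<real>\<^sup>n\<close>
  is a sequence vanishing from index \<open>n\<close> on, as in the library's \<^const>\<open>Euclidean_space\<close>.
\<close>

definition real_space :: "nat \<Rightarrow> (nat \<Rightarrow> real) metric"
  where "real_space n =
    metric (topspace (Euclidean_space n), \<lambda>x y. L2_set (\<lambda>i. x i - y i) {..<n})"

lemma Metric_space_real_space:
  "Metric_space (topspace (Euclidean_space n)) (\<lambda>x y. L2_set (\<lambda>i. x i - y i) {..<n})"
proof
  fix x y :: "nat \<Rightarrow> real"
  show "L2_set (\<lambda>i. x i - y i) {..<n} = L2_set (\<lambda>i. y i - x i) {..<n}"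
    by (simp add: L2_set_def power2_commute)
  assume "x \<in> topspace (Euclidean_space n)" "y \<in> topspace (Euclidean_space n)"
  then have "(\<forall>i<n. x i = y i) \<longleftrightarrow> x = y"
    by (auto simp: topspace_Euclidean_space fun_eq_iff) (metis not_le)
  then show "L2_set (\<lambda>i. x i - y i) {..<n} = 0 \<longleftrightarrow> x = y"
    by (auto simp: L2_set_eq_0_iff)
next
  fix x y z :: "nat \<Rightarrow> real"
  show "L2_set (\<lambda>i. x i - z i) {..<n}
      \<le> L2_set (\<lambda>i. x i - y i) {..<n} + L2_set (\<lambda>i. y i - z i) {..<n}"
    using L2_set_triangle_ineq[of "\<lambda>i. x i - y i" "\<lambda>i. y i - z i" "{..<n}"] by simp
qed simp

lemma mspace_real_space [simp]: "mspace (real_space n) = {x. \<forall>i\<ge>n. x i = 0}"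
  using Metric_space.mspace_metric[OF Metric_space_real_space]
  by (simp add: real_space_def topspace_Euclidean_space)

lemma mdist_real_space [simp]:
  "mdist (real_space n) = (\<lambda>x y. L2_set (\<lambda>i. x i - y i) {..<n})"
  using Metric_space.mdist_metric[OF Metric_space_real_space]
  by (simp add: real_space_def)

text \<open>The diameter is \<open>\<infinity>\<close> for unbounded sets and \<open>0\<close> for the empty set.\<close>

definition ediam :: "'a metric \<Rightarrow> 'a set \<Rightarrow> ennreal"
  where "ediam X E = (SUP (x, y) \<in> E \<times> E. ennreal (mdist X x y))"

text \<open>
  Hausdorff measure is an outer measure, defined on all subsets of the space. No normalising
  constant is used. The definition is meant for \<open>s > 0\<close>: with \<open>0 powr 0 = 0\<close> it is not the
  counting measure for \<open>s = 0\<close>. The real power is taken only of finite diameters, and the infimum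
  is \<open>\<infinity>\<close> if there is no admissible countable cover.
\<close>

definition hausdorff_content :: "'a metric \<Rightarrow> real \<Rightarrow> real \<Rightarrow> 'a set \<Rightarrow> ennreal"
  where "hausdorff_content X s \<delta> A =
    (INF E \<in> {E :: nat \<Rightarrow> 'a set.
        (\<forall>i. E i \<subseteq> mspace X \<and> ediam X (E i) \<le> ennreal \<delta>) \<and> A \<subseteq> (\<Union>i. E i)}.
      \<Sum>i. ennreal (enn2real (ediam X (E i)) powr s))"

definition hausdorff_measure :: "'a metric \<Rightarrow> real \<Rightarrow> 'a set \<Rightarrow> ennreal"
  where "hausdorff_measure X s A = (SUP \<delta> \<in> {0<..}. hausdorff_content X s \<delta> A)"

definition ahlfors_regular :: "'a metric \<Rightarrow> real \<Rightarrow> bool"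
  where "ahlfors_regular X s \<longleftrightarrow>
    (\<exists>C>0. \<forall>x \<in> mspace X. \<forall>r>0. ennreal r \<le> ediam X (mspace X) \<longrightarrow>
       ennreal (inverse C * r powr s) \<le> hausdorff_measure X s (mcball_of X x r) \<and>
       hausdorff_measure X s (mcball_of X x r) \<le> ennreal (C * r powr s))"

text \<open>
  Measures on \<open>X\<close> are outer measures on all subsets; the measurable sets are those satisfying
  Caratheodory's criterion, i.e. the members of \<^const>\<open>lambda_system\<close>.
\<close>

definition borel_sets :: "'a metric \<Rightarrow> 'a set set"
  where "borel_sets X = sigma_sets (mspace X) {V. openin (mtopology_of X) V}"

definition caratheodory_sets :: "'a metric \<Rightarrow> ('a set \<Rightarrow> ennreal) \<Rightarrow> 'a set set"
  where "caratheodory_sets X \<mu> = lambda_system (mspace X) (Pow (mspace X)) \<mu>"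

definition borel_regular :: "'a metric \<Rightarrow> ('a set \<Rightarrow> ennreal) \<Rightarrow> bool"
  where "borel_regular X \<mu> \<longleftrightarrow>
    outer_measure_space (Pow (mspace X)) \<mu> \<and>
    borel_sets X \<subseteq> caratheodory_sets X \<mu> \<and>
    (\<forall>A \<subseteq> mspace X. \<exists>B \<in> borel_sets X. A \<subseteq> B \<and> \<mu> B = \<mu> A)"

text \<open>
  \<open>v\<close> is a derivative at \<open>x\<close> of \<open>f\<close> with respect to \<open>\<phi> : U \<rightarrow> \<real>\<^sup>n\<close>; the limit is along \<open>y \<in> U\<close>
  with \<open>y \<noteq> x\<close>.
\<close>

definition has_chart_derivative ::
    "'a metric \<Rightarrow> 'a set \<Rightarrow> nat \<Rightarrow> ('a \<Rightarrow> nat \<Rightarrow> real) \<Rightarrow> ('a \<Rightarrow> real) \<Rightarrow> 'a \<Rightarrow> (nat \<Rightarrow> real) \<Rightarrow> bool"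
  where "has_chart_derivative X U n \<phi> f x v \<longleftrightarrow>
    ((\<lambda>y. \<bar>f y - f x - (\<Sum>j<n. v j * (\<phi> y j - \<phi> x j))\<bar> / mdist X x y) \<longlongrightarrow> 0)
      (atin_within (mtopology_of X) x U)"

definition lipschitz_chart ::
    "'a metric \<Rightarrow> ('a set \<Rightarrow> ennreal) \<Rightarrow> 'a set \<Rightarrow> nat \<Rightarrow> ('a \<Rightarrow> nat \<Rightarrow> real) \<Rightarrow> bool"
  where "lipschitz_chart X \<mu> U n \<phi> \<longleftrightarrow>
    U \<in> caratheodory_sets X \<mu> \<and> \<mu> U > 0 \<and> n > 0 \<and>
    Lipschitz_continuous_map (submetric X U) (real_space n) \<phi> \<and>
    (\<forall>f :: 'a \<Rightarrow> real. Lipschitz_continuous_map X euclidean_metric f \<longrightarrow>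
       \<mu> {x \<in> U. \<not> (\<exists>!v. v \<in> mspace (real_space n) \<and> has_chart_derivative X U n \<phi> f x v)} = 0)"

definition lipschitz_differentiability_space :: "'a metric \<Rightarrow> ('a set \<Rightarrow> ennreal) \<Rightarrow> bool"
  where "lipschitz_differentiability_space X \<mu> \<longleftrightarrow>
    borel_regular X \<mu> \<and>
    (\<exists>\<A> :: ('a set \<times> nat \<times> ('a \<Rightarrow> nat \<Rightarrow> real)) set.
       (\<forall>(U, n, \<phi>) \<in> \<A>. lipschitz_chart X \<mu> U n \<phi>) \<and>
       (\<Union>(U, n, \<phi>) \<in> \<A>. U) = mspace X)"

definition strongly_unrectifiable :: "'a metric \<Rightarrow> real \<Rightarrow> 'a set \<Rightarrow> bool"
  where "strongly_unrectifiable X s U \<longleftrightarrow>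
    (\<forall>N f. Lipschitz_continuous_map (submetric X U) (real_space N) f \<longrightarrow>
       hausdorff_measure (real_space N) s (f ` U) = 0)"

end

theory Submission
  imports Defs
begin

text \<open>
  Let \<open>f : U \<rightarrow> \<real>\<^sup>N\<close> be Lipschitz. Each of its coordinates extends to a Lipschitz function on \<open>X\<close>, so
  outside a null set, whose image is null, \<open>f\<close> is differentiable with respect to the chart:
  \<open>f y = f x + D (\<phi> y - \<phi> x) + o(d(x,y))\<close> with \<open>D : \<real>\<^sup>k \<rightarrow> \<real>\<^sup>N\<close> linear. On a small ball of radius \<open>r\<close>
  about \<open>x\<close>, up to an error \<open>r/m\<close>, the image of \<open>f\<close> therefore has at most \<open>k\<close> dimensions: it is
  covered by about \<open>m\<^sup>k\<close> sets of diameter about \<open>r/m\<close>, which contribute \<open>m\<^sup>k\<^sup>-\<^sup>s r\<^sup>s\<close> to the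
  \<open>s\<close>-dimensional content (\<open>hausdorff_content_image_chart_ball_le\<close>). By Ahlfors regularity \<open>r\<^sup>s\<close> is
  at most a constant times the measure of the ball, and Vitali's covering theorem sums these bounds
  over disjoint balls to a constant times \<open>m\<^sup>k\<^sup>-\<^sup>s\<close> (\<open>ahlfors_regular_Vitali\<close>,
  \<open>hausdorff_measure_image_linear_null\<close>). This tends to \<open>0\<close> as \<open>m\<close> tends to infinity, because
  \<open>k < s\<close>.

  The constants depend on a bound for \<open>D\<close> and, through the measure of a ball that contains the
  points considered, on a bound for their distance to a fixed point. So the estimate is applied to
  the countably many sets on which both bounds are a given natural number.
\<close>

section \<open>Hausdorff measure\<close>

lemma ediam_le_iff:
  "ediam X E \<le> ennreal d \<longleftrightarrow> (\<forall>x\<in>E. \<forall>y\<in>E. ennreal (mdist X x y) \<le> ennreal d)"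
  by (auto simp: ediam_def SUP_le_iff)

lemma ediam_mono: "E \<subseteq> F \<Longrightarrow> ediam X E \<le> ediam X F"
  unfolding ediam_def by (rule SUP_subset_mono) auto

lemma hausdorff_content_le_cover:
  assumes "\<And>i. E i \<subseteq> mspace X" "\<And>i. ediam X (E i) \<le> ennreal \<delta>" "A \<subseteq> (\<Union>i. E i)"
  shows "hausdorff_content X s \<delta> A \<le> (\<Sum>i. ennreal (enn2real (ediam X (E i)) powr s))"
  unfolding hausdorff_content_def by (rule INF_lower) (use assms in auto)

lemma hausdorff_content_mono:
  assumes "A \<subseteq> B"
  shows "hausdorff_content X s \<delta> A \<le> hausdorff_content X s \<delta> B"
  unfolding hausdorff_content_def by (rule INF_superset_mono) (use assms in auto)

lemma hausdorff_measure_mono: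
  assumes "A \<subseteq> B"
  shows "hausdorff_measure X s A \<le> hausdorff_measure X s B"
  unfolding hausdorff_measure_def
  by (rule SUP_mono) (use hausdorff_content_mono[OF assms] in auto)

lemma hausdorff_content_le_measure:
  "\<delta> > 0 \<Longrightarrow> hausdorff_content X s \<delta> A \<le> hausdorff_measure X s A"
  unfolding hausdorff_measure_def by (rule SUP_upper) auto

lemma hausdorff_measure_eq_0I:
  assumes "\<And>\<delta>. \<delta> > 0 \<Longrightarrow> hausdorff_content X s \<delta> A = 0"
  shows "hausdorff_measure X s A = 0"
  using assms by (auto simp: hausdorff_measure_def bot_ennreal[symmetric])

lemma hausdorff_content_le_powr:
  assumes "s > 0" "A \<subseteq> mspace X" "ediam X A \<le> ennreal d" "0 \<le> d" "d \<le> \<delta>"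
  shows "hausdorff_content X s \<delta> A \<le> ennreal (d powr s)"
proof -
  define E :: "nat \<Rightarrow> 'a set" where "E i = (if i = 0 then A else {})" for i
  have e: "ediam X (E i) \<le> ennreal \<delta>" for i
    using order_trans[OF assms(3) ennreal_leI[OF assms(5)]]
    by (auto simp: E_def ediam_def bot_ennreal)
  have "hausdorff_content X s \<delta> A \<le> (\<Sum>i. ennreal (enn2real (ediam X (E i)) powr s))"
    by (rule hausdorff_content_le_cover) (use assms e in \<open>auto simp: E_def split: if_splits\<close>)
  also have "\<dots> = (\<Sum>i\<in>{0}. ennreal (enn2real (ediam X (E i)) powr s))"
    by (rule suminf_finite) (auto simp: E_def ediam_def bot_ennreal)
  also have "\<dots> \<le> ennreal (d powr s)"
    using assms enn2real_leI[OF assms(4,3)]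
    by (auto simp: E_def intro!: ennreal_leI powr_mono2)
  finally show ?thesis .
qed

lemma hausdorff_content_empty:
  assumes "\<delta> > 0" "s > 0"
  shows "hausdorff_content X s \<delta> {} = 0"
  using hausdorff_content_le_powr[of s "{}" X 0 \<delta>] assms by (simp add: ediam_def bot_ennreal)

text \<open>
  Each \<open>A n\<close> has a cover whose sum exceeds the content by at most \<open>\<epsilon>/2\<^sup>n\<^sup>+\<^sup>1\<close>; the union of
  these covers, enumerated by pairs, covers \<open>\<Union>n. A n\<close>.
\<close>

lemma hausdorff_content_UN_le_suminf:
  fixes A :: "nat \<Rightarrow> 'a set"
  shows "hausdorff_content X s \<delta> (\<Union>n. A n) \<le> (\<Sum>n. hausdorff_content X s \<delta> (A n))"
proof (rule ennreal_le_epsilon)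
  fix e :: real
  let ?H = "hausdorff_content X s \<delta>"
  let ?w = "\<lambda>E. ennreal (enn2real (ediam X E) powr s)"
  let ?C = "\<lambda>A. {E :: nat \<Rightarrow> 'a set.
        (\<forall>i. E i \<subseteq> mspace X \<and> ediam X (E i) \<le> ennreal \<delta>) \<and> A \<subseteq> (\<Union>i. E i)}"
  assume e: "0 < e" and fin: "(\<Sum>n. ?H (A n)) < top"
  have close: "\<exists>E\<in>?C (A n). (\<Sum>i. ?w (E i)) < ?H (A n) + ennreal (e * (1/2) ^ Suc n)" for n
  proof (rule INF_approx_ennreal)
    show "?H (A n) = (INF E\<in>?C (A n). \<Sum>i. ?w (E i))"
      by (simp add: hausdorff_content_def)
    show "?H (A n) \<noteq> \<infinity>"
      using ennreal_suminf_lessD[OF fin, of n] by simp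
  qed (use e in simp)
  have "\<exists>E. E \<in> ?C (A n) \<and> (\<Sum>i. ?w (E i)) \<le> ?H (A n) + ennreal (e * (1/2) ^ Suc n)" for n
  proof -
    obtain E where "E \<in> ?C (A n)" "(\<Sum>i. ?w (E i)) < ?H (A n) + ennreal (e * (1/2) ^ Suc n)"
      using close by (rule bexE)
    then show ?thesis
      by (intro exI[of _ E] conjI less_imp_le)
  qed
  then have "\<forall>n. \<exists>E. E \<in> ?C (A n) \<and> (\<Sum>i. ?w (E i)) \<le> ?H (A n) + ennreal (e * (1/2) ^ Suc n)"
    by (rule allI)
  then obtain E where E: "\<forall>n. E n \<in> ?C (A n) \<and>
      (\<Sum>i. ?w (E n i)) \<le> ?H (A n) + ennreal (e * (1/2) ^ Suc n)"
    by (rule choice[THEN exE])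
  have E_sub: "E n i \<subseteq> mspace X" and E_diam: "ediam X (E n i) \<le> ennreal \<delta>"
    and E_cover: "A n \<subseteq> (\<Union>i. E n i)" for n i
    using spec[OF E, of n, THEN conjunct1] by auto
  have E_sum: "(\<Sum>i. ?w (E n i)) \<le> ?H (A n) + ennreal (e * (1/2) ^ Suc n)" for n
    using spec[OF E, of n] by (rule conjunct2)
  define C where "C i = E (fst (prod_decode i)) (snd (prod_decode i))" for i
  have "?H (\<Union>n. A n) \<le> (\<Sum>i. ?w (C i))"
  proof (rule hausdorff_content_le_cover)
    show "(\<Union>n. A n) \<subseteq> (\<Union>i. C i)"
    proof
      fix x assume "x \<in> (\<Union>n. A n)"
      then obtain n i where "x \<in> E n i" using E_cover by blast
      then have "x \<in> C (prod_encode (n, i))" by (simp add: C_def)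
      then show "x \<in> (\<Union>i. C i)" by blast
    qed
  qed (use E_sub E_diam in \<open>auto simp: C_def\<close>)
  also have "\<dots> = (\<Sum>n. \<Sum>i. ?w (E n i))"
    using suminf_ennreal_2dimen[where f = "\<lambda>p. ?w (E (fst p) (snd p))", OF refl]
    by (simp add: C_def)
  also have "\<dots> \<le> (\<Sum>n. ?H (A n) + ennreal (e * (1/2) ^ Suc n))"
    by (intro suminf_le E_sum) auto
  also have "\<dots> = (\<Sum>n. ?H (A n)) + (\<Sum>n. ennreal (e * (1/2) ^ Suc n))"
    by (rule suminf_add[symmetric]) auto
  also have "(\<Sum>n. ennreal (e * (1/2) ^ Suc n)) = ennreal e"
    using sums_mult[OF power_half_series, of e] e
    by (intro suminf_ennreal_eq) auto
  finally show "?H (\<Union>n. A n) \<le> (\<Sum>n. ?H (A n)) + ennreal e" .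
qed

lemma hausdorff_measure_UN_null:
  fixes A :: "nat \<Rightarrow> 'a set"
  assumes "\<And>n. hausdorff_measure X s (A n) = 0"
  shows "hausdorff_measure X s (\<Union>n. A n) = 0"
proof -
  have "hausdorff_content X s \<delta> (\<Union>n. A n) = 0" if "\<delta> > 0" for \<delta>
  proof -
    have "hausdorff_content X s \<delta> (A n) = 0" for n
      using hausdorff_content_le_measure[OF that, of X s "A n"] assms[of n] by simp
    then show ?thesis
      using hausdorff_content_UN_le_suminf[of X s \<delta> A] by simp
  qed
  then show ?thesis
    by (rule hausdorff_measure_eq_0I)
qed

lemma hausdorff_measure_Un_null:
  assumes "hausdorff_measure X s A = 0" "hausdorff_measure X s B = 0"
  shows "hausdorff_measure X s (A \<union> B) = 0"
proof -
  have "A \<union> B = (\<Union>n::nat. if n = 0 then A else B)"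
    by (auto split: if_splits)
  then show ?thesis
    using assms hausdorff_measure_UN_null[of X s "\<lambda>n. if n = 0 then A else B"] by simp
qed

text \<open>
  Subadditivity in the form in which covering theorems supply their data: a countable index set,
  and a bound only on the finite partial sums of the weights.
\<close>

lemma hausdorff_content_UN_le:
  assumes "s > 0" "\<delta> > 0" "countable I"
    and A: "\<And>i. i \<in> I \<Longrightarrow> hausdorff_content X s \<delta> (A i) \<le> ennreal (w i)"
    and w: "\<And>i. i \<in> I \<Longrightarrow> w i \<ge> 0"
    and K: "\<And>F. finite F \<Longrightarrow> F \<subseteq> I \<Longrightarrow> sum w F \<le> K"
  shows "hausdorff_content X s \<delta> (\<Union>i\<in>I. A i) \<le> ennreal K"
proof -
  define J where "J = to_nat_on I ` I"
  define g where "g = from_nat_into I"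
  have gI: "g n \<in> I" if "n \<in> J" for n
    using that assms(3) by (auto simp: J_def g_def)
  have inj: "inj_on g J"
    using assms(3) by (auto simp: J_def g_def inj_on_def)
  define B where "B n = (if n \<in> J then A (g n) else {})" for n
  have "(\<Union>i\<in>I. A i) \<subseteq> (\<Union>n. B n)"
    using assms(3) by (fastforce simp: B_def J_def g_def)
  then have "hausdorff_content X s \<delta> (\<Union>i\<in>I. A i) \<le> hausdorff_content X s \<delta> (\<Union>n. B n)"
    by (rule hausdorff_content_mono)
  also have "\<dots> \<le> (\<Sum>n. hausdorff_content X s \<delta> (B n))"
    by (rule hausdorff_content_UN_le_suminf)
  also have "\<dots> \<le> ennreal K"
  proof (rule suminf_le_const)
    fix m
    have "(\<Sum>n<m. hausdorff_content X s \<delta> (B n)) = (\<Sum>n\<in>{..<m} \<inter> J. hausdorff_content X s \<delta> (B n))"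
      by (rule sum.mono_neutral_right) (auto simp: B_def hausdorff_content_empty assms)
    also have "\<dots> \<le> (\<Sum>n\<in>{..<m} \<inter> J. ennreal (w (g n)))"
      by (rule sum_mono) (auto simp: B_def intro: A gI)
    also have "\<dots> = ennreal (\<Sum>n\<in>{..<m} \<inter> J. w (g n))"
      by (rule sum_ennreal) (auto intro: w gI)
    also have "(\<Sum>n\<in>{..<m} \<inter> J. w (g n)) = sum w (g ` ({..<m} \<inter> J))"
      by (subst sum.reindex) (auto intro: inj_on_subset[OF inj])
    also have "\<dots> \<le> K"
      by (rule K) (auto intro: gI)
    finally show "(\<Sum>n<m. hausdorff_content X s \<delta> (B n)) \<le> ennreal K"
      by (simp add: ennreal_leI)
  qed auto
  finally show ?thesis .
qed

lemma ediam_Lipschitz_image_le: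
  assumes "L > 0" and d: "ediam X E \<le> ennreal d" and "0 \<le> d"
    and L: "\<And>x y. x \<in> E \<Longrightarrow> y \<in> E \<Longrightarrow> mdist Y (f x) (f y) \<le> L * mdist X x y"
  shows "ediam Y (f ` E) \<le> ennreal (L * d)"
proof -
  have "mdist X x y \<le> d" if "x \<in> E" "y \<in> E" for x y
    using d that \<open>0 \<le> d\<close> by (auto simp: ediam_le_iff)
  then have "mdist Y (f x) (f y) \<le> L * d" if "x \<in> E" "y \<in> E" for x y
    using order_trans[OF L mult_left_mono] \<open>L > 0\<close> that by simp
  then show ?thesis
    by (auto simp: ediam_le_iff intro!: ennreal_leI)
qed

text \<open>
  An \<open>L\<close>-Lipschitz map multiplies the sums \<open>\<Sum> diam\<^sup>s\<close> by at most \<open>L\<^sup>s\<close>. The covering sets may leave the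
  domain \<open>U\<close> of the map, so they are intersected with \<open>U\<close> first.
\<close>

lemma hausdorff_measure_Lipschitz_image_null:
  assumes "s > 0" "Lipschitz_continuous_map (submetric X U) Y f"
    and Z: "Z \<subseteq> U" "U \<subseteq> mspace X" "hausdorff_measure X s Z = 0"
  shows "hausdorff_measure Y s (f ` Z) = 0"
proof -
  obtain L where L: "L > 0" "\<And>x y. x \<in> U \<Longrightarrow> y \<in> U \<Longrightarrow> mdist Y (f x) (f y) \<le> L * mdist X x y"
    and fU: "f ` U \<subseteq> mspace Y"
    using assms(2) Z(2) unfolding Lipschitz_continuous_map_pos
    by (metis Int_absorb2 mdist_submetric mspace_submetric image_subset_iff_funcset)
  have small: "hausdorff_content Y s \<delta> (f ` Z) \<le> 0 + ennreal e" if \<delta>: "\<delta> > 0" and e: "e > 0" for \<delta> e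
  proof -
    have "hausdorff_content X s (\<delta> / L) Z = 0"
      using hausdorff_content_le_measure[of "\<delta> / L" X s Z] Z(3) \<delta> L(1) by simp
    then have "hausdorff_content X s (\<delta> / L) Z < ennreal (e / L powr s)"
      using e L(1) by simp
    then obtain E :: "nat \<Rightarrow> 'a set" where E: "\<And>i. E i \<subseteq> mspace X" "\<And>i. ediam X (E i) \<le> ennreal (\<delta> / L)" "Z \<subseteq> (\<Union>i. E i)"
      and sm: "(\<Sum>i. ennreal (enn2real (ediam X (E i)) powr s)) < ennreal (e / L powr s)"
      unfolding hausdorff_content_def INF_less_iff by auto
    define d where "d i = enn2real (ediam X (E i))" for i
    have d: "ediam X (E i) = ennreal (d i)" "0 \<le> d i" for i
      using order.strict_trans1[OF E(2)[of i]] by (simp_all add: d_def)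
    have dle: "d i \<le> \<delta> / L" for i
      using E(2)[of i] \<delta> L(1) unfolding d(1) by simp
    define F where "F i = f ` (E i \<inter> U)" for i
    have Fd: "ediam Y (F i) \<le> ennreal (L * d i)" for i
      unfolding F_def
      by (rule ediam_Lipschitz_image_le[of _ X])
        (use L d ediam_mono[of "E i \<inter> U" "E i" X] in auto)
    have "hausdorff_content Y s \<delta> (f ` Z) \<le> (\<Sum>i. ennreal (enn2real (ediam Y (F i)) powr s))"
    proof (rule hausdorff_content_le_cover)
      show "ediam Y (F i) \<le> ennreal \<delta>" for i
        using Fd[of i] dle[of i] L(1) by (auto simp: field_simps elim!: order_trans intro!: ennreal_leI)
      show "f ` Z \<subseteq> (\<Union>i. F i)"
        using E(3) Z(1) by (fastforce simp: F_def)
    qed (use fU in \<open>auto simp: F_def\<close>)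
    also have "\<dots> \<le> (\<Sum>i. ennreal (L powr s) * ennreal (d i powr s))"
    proof (rule suminf_le)
      fix i
      have "enn2real (ediam Y (F i)) \<le> L * d i"
        using Fd[of i] L d by (intro enn2real_leI) auto
      then show "ennreal (enn2real (ediam Y (F i)) powr s) \<le> ennreal (L powr s) * ennreal (d i powr s)"
        using L d(2) \<open>s > 0\<close>
        by (subst ennreal_mult[symmetric]) (auto intro!: ennreal_leI powr_mono2 simp flip: powr_mult)
    qed auto
    also have "\<dots> \<le> ennreal (L powr s) * ennreal (e / L powr s)"
      using sm unfolding d_def by (simp add: mult_left_mono)
    also have "\<dots> = ennreal e"
      using L e by (subst ennreal_mult[symmetric]) auto
    finally show ?thesis by simp
  qed
  have "hausdorff_content Y s \<delta> (f ` Z) = 0" if "\<delta> > 0" for \<delta>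
    using ennreal_le_epsilon[of 0, OF small[OF that]] by simp
  then show ?thesis
    by (rule hausdorff_measure_eq_0I)
qed

lemma hausdorff_measure_ediam_0:
  assumes "s > 0" "A \<subseteq> mspace X" "ediam X A = 0"
  shows "hausdorff_measure X s A = 0"
proof -
  have "hausdorff_content X s \<delta> A = 0" if "\<delta> > 0" for \<delta>
    using hausdorff_content_le_powr[of s A X 0 \<delta>] assms that by simp
  then show ?thesis
    by (rule hausdorff_measure_eq_0I)
qed

section \<open>Covering by balls in Ahlfors regular spaces\<close>

text \<open>
  Zorn's lemma gives a maximal disjoint family subject to the condition that every ball of the
  original family that meets the subfamily meets a member of at least half its radius. If some ball
  met no member, one of nearly maximal radius among these could be added; hence all balls meet the
  family, and the triangle inequality puts each centre within \<open>r x + r y \<le> 3 * r y\<close> of some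
  selected \<open>y\<close>. Covering the centres rather than the balls makes the factor 3 instead of 5.
\<close>

lemma Vitali_covering_mcball_of:
  fixes r :: "'a \<Rightarrow> real"
  assumes A: "A \<subseteq> mspace X" and r: "\<And>x. x \<in> A \<Longrightarrow> 0 < r x \<and> r x \<le> R"
  obtains S where "S \<subseteq> A" "disjoint_family_on (\<lambda>x. mcball_of X x (r x)) S"
    "A \<subseteq> (\<Union>y\<in>S. mcball_of X y (3 * r y))"
proof -
  define meets where "meets x y \<longleftrightarrow> mcball_of X x (r x) \<inter> mcball_of X y (r y) \<noteq> {}" for x y
  define \<C> where "\<C> = {S. S \<subseteq> A \<and> (\<forall>x\<in>S. \<forall>y\<in>S. x \<noteq> y \<longrightarrow> \<not> meets x y) \<and>
    (\<forall>x\<in>A. (\<exists>y\<in>S. meets x y) \<longrightarrow> (\<exists>y\<in>S. meets x y \<and> r x \<le> 2 * r y))}"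
  have \<C>D: "S \<subseteq> A" "\<And>x y. x \<in> S \<Longrightarrow> y \<in> S \<Longrightarrow> x \<noteq> y \<Longrightarrow> \<not> meets x y"
    "\<And>x y. x \<in> A \<Longrightarrow> y \<in> S \<Longrightarrow> meets x y \<Longrightarrow> \<exists>y\<in>S. meets x y \<and> r x \<le> 2 * r y"
    if "S \<in> \<C>" for S
    using that by (auto simp: \<C>_def)
  have \<C>I: "S \<in> \<C>" if "S \<subseteq> A" "\<And>x y. x \<in> S \<Longrightarrow> y \<in> S \<Longrightarrow> x \<noteq> y \<Longrightarrow> \<not> meets x y"
    "\<And>x y. x \<in> A \<Longrightarrow> y \<in> S \<Longrightarrow> meets x y \<Longrightarrow> \<exists>y\<in>S. meets x y \<and> r x \<le> 2 * r y" for S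
    using that by (auto simp: \<C>_def)
  have meets_sym: "meets x y \<longleftrightarrow> meets y x" for x y
    by (auto simp: meets_def Int_commute)
  have self: "meets x x" if "x \<in> A" for x
  proof -
    have "mdist X x x = 0"
      using subsetD[OF A that] by simp
    then have "mdist X x x \<le> r x"
      using r[OF that] by linarith
    then have "x \<in> mcball_of X x (r x)"
      using subsetD[OF A that] by simp
    then show ?thesis
      unfolding meets_def by blast
  qed
  have "\<exists>S\<in>\<C>. \<forall>T\<in>\<C>. S \<subseteq> T \<longrightarrow> T = S"
  proof (rule subset_Zorn')
    fix \<D> assume "subset.chain \<C> \<D>"
    then have sub: "\<D> \<subseteq> \<C>" and ch: "\<And>S T. S \<in> \<D> \<Longrightarrow> T \<in> \<D> \<Longrightarrow> S \<subseteq> T \<or> T \<subseteq> S"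
      by (auto simp: subset_chain_def)
    show "\<Union>\<D> \<in> \<C>"
    proof (rule \<C>I)
      show "\<Union>\<D> \<subseteq> A"
        using sub \<C>D(1) by blast
    next
      fix x y assume "x \<in> \<Union>\<D>" "y \<in> \<Union>\<D>" and ne: "x \<noteq> y"
      then obtain S T where "S \<in> \<D>" "x \<in> S" "T \<in> \<D>" "y \<in> T" by blast
      then obtain S where "S \<in> \<D>" "x \<in> S" "y \<in> S" using ch[of S T] by blast
      then show "\<not> meets x y"
        using \<C>D(2) sub ne by blast
    next
      fix x y assume x: "x \<in> A" and "y \<in> \<Union>\<D>" "meets x y"
      then obtain S where S: "S \<in> \<D>" "y \<in> S" by blast
      then show "\<exists>y\<in>\<Union>\<D>. meets x y \<and> r x \<le> 2 * r y"
        using \<C>D(3)[of S x y] x \<open>meets x y\<close> sub by blast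
    qed
  qed
  then obtain S where S: "S \<in> \<C>" and max: "\<And>T. T \<in> \<C> \<Longrightarrow> S \<subseteq> T \<Longrightarrow> T = S"
    by blast
  have SA: "S \<subseteq> A"
    by (rule \<C>D(1)[OF S])
  have all: "\<exists>y\<in>S. meets x y" if x: "x \<in> A" for x
  proof (rule ccontr)
    define W where "W = {x \<in> A. \<not> (\<exists>y\<in>S. meets x y)}"
    assume "\<not> (\<exists>y\<in>S. meets x y)"
    then have xW: "x \<in> W" using x by (simp add: W_def)
    have bdd: "bdd_above (r ` W)"
      using r by (auto simp: W_def intro!: bdd_aboveI2[where M = R])
    define \<sigma> where "\<sigma> = Sup (r ` W)"
    have le: "r z \<le> \<sigma>" if "z \<in> W" for z
      unfolding \<sigma>_def using bdd that by (simp add: cSup_upper)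
    have "\<sigma> > 0"
      using r[OF x] le[OF xW] by simp
    then have "\<sigma> / 2 < Sup (r ` W)"
      unfolding \<sigma>_def[symmetric] by simp
    then obtain z where z: "z \<in> W" "\<sigma> / 2 < r z"
      using less_cSup_iff[OF _ bdd] xW by blast
    have zA: "z \<in> A" and znot: "\<not> (\<exists>y\<in>S. meets z y)"
      using z by (auto simp: W_def)
    have "insert z S \<in> \<C>"
    proof (rule \<C>I)
      show "insert z S \<subseteq> A"
        using SA zA by blast
      show "\<not> meets x y" if "x \<in> insert z S" "y \<in> insert z S" "x \<noteq> y" for x y
        using that znot \<C>D(2)[OF S, of x y] meets_sym[of x y] by blast
      fix w y assume w: "w \<in> A" and y: "y \<in> insert z S" "meets w y"
      show "\<exists>y\<in>insert z S. meets w y \<and> r w \<le> 2 * r y"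
      proof (cases "\<exists>y\<in>S. meets w y")
        case True
        then show ?thesis using \<C>D(3)[OF S w] by blast
      next
        case False
        then have "w \<in> W" "meets w z" using w y by (auto simp: W_def)
        then show ?thesis using le[of w] z(2) by auto
      qed
    qed
    then have "z \<in> S" using max[of "insert z S"] by blast
    then show False using znot self zA by blast
  qed
  show ?thesis
  proof
    show "A \<subseteq> (\<Union>y\<in>S. mcball_of X y (3 * r y))"
    proof
      fix x assume x: "x \<in> A"
      obtain y where y: "y \<in> S" "meets x y" "r x \<le> 2 * r y"
        using \<C>D(3)[OF S x] all[OF x] by blast
      then obtain z where z: "x \<in> mspace X" "y \<in> mspace X" "z \<in> mspace X"
        "mdist X x z \<le> r x" "mdist X y z \<le> r y"
        by (auto simp: meets_def)
      have "mdist X y x \<le> mdist X y z + mdist X x z"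
        using mdist_triangle[OF z(2,3,1)] mdist_commute[of X x z] by simp
      then have "x \<in> mcball_of X y (3 * r y)"
        using z y(3) by simp
      then show "x \<in> (\<Union>y\<in>S. mcball_of X y (3 * r y))"
        using y(1) by blast
    qed
    show "disjoint_family_on (\<lambda>x. mcball_of X x (r x)) S"
      using \<C>D(2)[OF S] by (auto simp: disjoint_family_on_def meets_def)
  qed (rule SA)
qed

lemma mcball_of_in_borel_sets: "mcball_of X x r \<in> borel_sets X"
proof -
  interpret Metric_space "mspace X" "mdist X" by (rule Metric_space_mspace_mdist)
  have "openin (mtopology_of X) (mspace X - mcball_of X x r)"
    using closedin_mcball[of x r] by (simp add: closedin_def mtopology_of_def mcball_of_def)
  then have "mspace X - (mspace X - mcball_of X x r) \<in> borel_sets X"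
    unfolding borel_sets_def by (intro sigma_sets.Compl sigma_sets.Basic) auto
  moreover have "mspace X - (mspace X - mcball_of X x r) = mcball_of X x r"
    by auto
  ultimately show ?thesis by simp
qed

text \<open>
  Borel sets satisfy Caratheodory's criterion, so an outer measure is finitely additive on them.
\<close>

lemma sum_borel_regular_disjoint:
  assumes "borel_regular X \<mu>" "finite F"
    and B: "\<And>x. x \<in> F \<Longrightarrow> B x \<in> borel_sets X" and "disjoint_family_on B F"
  shows "(\<Sum>x\<in>F. \<mu> (B x)) = \<mu> (\<Union>x\<in>F. B x)"
  using assms(2,3,4)
proof (induction F rule: finite_induct)
  case empty
  then show ?case
    using assms(1) by (simp add: borel_regular_def outer_measure_space_def positive_def)
next
  case (insert a F)
  have sub: "B x \<in> caratheodory_sets X \<mu>" if "x \<in> insert a F" for x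
    using assms(1) insert.prems(1)[OF that] by (auto simp: borel_regular_def)
  then have sub2: "B x \<subseteq> mspace X" if "x \<in> insert a F" for x
    using that by (force simp: caratheodory_sets_def lambda_system_def)
  let ?V = "\<Union>x\<in>insert a F. B x"
  have disj: "B a \<inter> B x = {}" if "x \<in> F" for x
    using insert.prems(2) insert.hyps(2) that by (auto simp: disjoint_family_on_def)
  have "\<mu> (B a \<inter> ?V) + \<mu> ((mspace X - B a) \<inter> ?V) = \<mu> ?V"
  proof -
    have "?V \<in> Pow (mspace X)" using sub2 by blast
    moreover have "B a \<in> caratheodory_sets X \<mu>" using sub by blast
    ultimately show ?thesis
      unfolding caratheodory_sets_def lambda_system_def by blast
  qed
  moreover have "B a \<inter> ?V = B a" by auto
  moreover have "(mspace X - B a) \<inter> ?V = (\<Union>x\<in>F. B x)"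
    using disj sub2 by blast
  moreover have "(\<Sum>x\<in>F. \<mu> (B x)) = \<mu> (\<Union>x\<in>F. B x)"
    by (rule insert.IH) (use insert.prems in \<open>auto simp: disjoint_family_on_def\<close>)
  ultimately show ?case
    using insert.hyps by simp
qed

text \<open>
  The upper regularity bound speaks only of radii up to the diameter. A ball of larger radius is the
  whole space, which is also the ball whose radius is the diameter.
\<close>

lemma ahlfors_regular_mcball_finite:
  assumes "ahlfors_regular X s" "ediam X (mspace X) \<noteq> 0" "p \<in> mspace X" "R > 0"
  shows "hausdorff_measure X s (mcball_of X p R) < \<infinity>"
proof -
  obtain C where C: "\<And>x r. x \<in> mspace X \<Longrightarrow> r > 0 \<Longrightarrow> ennreal r \<le> ediam X (mspace X) \<Longrightarrow>
      hausdorff_measure X s (mcball_of X x r) \<le> ennreal (C * r powr s)"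
    using assms(1) by (auto simp: ahlfors_regular_def)
  have "\<exists>r>0. ennreal r \<le> ediam X (mspace X) \<and> mcball_of X p R \<subseteq> mcball_of X p r"
  proof (cases "ennreal R \<le> ediam X (mspace X)")
    case False
    define d where "d = enn2real (ediam X (mspace X))"
    have d: "ediam X (mspace X) = ennreal d" "0 \<le> d"
      using False by (simp_all add: d_def not_le order.strict_trans[OF _ ennreal_less_top])
    then have "d > 0" using assms(2) by (cases "d = 0") auto
    moreover have "mdist X p y \<le> d" if "y \<in> mspace X" for y
      using ediam_le_iff[of X "mspace X" d] d that assms(3) by auto
    ultimately show ?thesis
      using d by (intro exI[of _ d]) auto
  qed (use assms(4) in auto)
  then obtain r where r: "r > 0" "ennreal r \<le> ediam X (mspace X)" "mcball_of X p R \<subseteq> mcball_of X p r"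
    by blast
  have "hausdorff_measure X s (mcball_of X p R) \<le> ennreal (C * r powr s)"
    using hausdorff_measure_mono[OF r(3)] C[OF assms(3) r(1,2)] by (rule order_trans)
  then show ?thesis
    using order.strict_trans1 by fastforce
qed

lemma countable_if_bounded_sums:
  fixes w :: "'a \<Rightarrow> real"
  assumes "\<And>x. x \<in> S \<Longrightarrow> w x > 0" "\<And>F. finite F \<Longrightarrow> F \<subseteq> S \<Longrightarrow> sum w F \<le> K"
  shows "countable S"
proof -
  have "w summable_on S"
  proof (rule nonneg_bdd_above_summable_on)
    show "w x \<ge> 0" if "x \<in> S" for x
      using assms(1)[OF that] by simp
    show "bdd_above (sum w ` {F. F \<subseteq> S \<and> finite F})"
      by (rule bdd_aboveI2[where M = K]) (simp add: assms(2))
  qed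
  moreover have "(\<lambda>x. norm (w x)) summable_on S \<longleftrightarrow> w summable_on S"
    by (rule summable_on_cong) (simp add: assms(1) less_imp_le)
  ultimately have "(\<lambda>x. norm (w x)) summable_on S"
    by simp
  then have "countable {x\<in>S. w x \<noteq> 0}"
    by (rule Infinite_Sum.abs_summable_countable)
  also have "{x\<in>S. w x \<noteq> 0} = S"
    using assms(1) by force
  finally show ?thesis .
qed

text \<open>
  The disjoint balls selected by Vitali's theorem have measure at least \<open>r\<^sup>s / C\<close> each and lie in one
  fixed ball of finite measure. So \<open>\<Sum> r\<^sup>s\<close> is bounded by a constant \<open>K\<close> that depends neither on
  the radii nor on the set \<open>A\<close>; this uniformity is what allows the radii to be chosen afterwards,
  depending on the accuracy of a linear approximation. Countability of \<open>S\<close> is a consequence of the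
  bound.
\<close>

lemma ahlfors_regular_Vitali:
  assumes br: "borel_regular X (hausdorff_measure X s)" and ar: "ahlfors_regular X s"
    and diam: "ediam X (mspace X) \<noteq> 0" and p: "p \<in> mspace X" and "R > 0"
  obtains K \<rho> :: real where "K \<ge> 0" "\<rho> > 0"
    "\<forall>A r. A \<subseteq> mcball_of X p R \<longrightarrow> (\<forall>x\<in>A. 0 < r x \<and> r x \<le> \<rho>) \<longrightarrow>
      (\<exists>S\<subseteq>A. countable S \<and> A \<subseteq> (\<Union>y\<in>S. mcball_of X y (3 * r y)) \<and>
        (\<forall>F. finite F \<longrightarrow> F \<subseteq> S \<longrightarrow> (\<Sum>y\<in>F. r y powr s) \<le> K))"
proof -
  obtain C where C: "C > 0" "\<And>x r. x \<in> mspace X \<Longrightarrow> r > 0 \<Longrightarrow> ennreal r \<le> ediam X (mspace X) \<Longrightarrow>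
      ennreal (inverse C * r powr s) \<le> hausdorff_measure X s (mcball_of X x r)"
    using ar by (auto simp: ahlfors_regular_def)
  obtain \<rho> where \<rho>: "\<rho> > 0" "\<rho> \<le> 1" "ennreal \<rho> \<le> ediam X (mspace X)"
  proof (cases "ediam X (mspace X)" rule: ennreal_cases)
    case (real d)
    then show ?thesis using diam that[of "min 1 d"] by (cases "d = 0") (auto intro!: ennreal_leI)
  next
    case top
    then show ?thesis using that[of 1] by simp
  qed
  define h where "h = enn2real (hausdorff_measure X s (mcball_of X p (R + 1)))"
  have h: "hausdorff_measure X s (mcball_of X p (R + 1)) = ennreal h" "h \<ge> 0"
    using ahlfors_regular_mcball_finite[OF ar diam p, of "R + 1"] \<open>R > 0\<close> by (simp_all add: h_def)
  show ?thesis
  proof (rule that[of "C * h" \<rho>], goal_cases)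
    case 3
    show ?case
    proof (intro allI impI)
      fix A and r :: "'a \<Rightarrow> real"
      assume A: "A \<subseteq> mcball_of X p R" and "\<forall>x\<in>A. 0 < r x \<and> r x \<le> \<rho>"
      then have r: "0 < r x \<and> r x \<le> \<rho>" if "x \<in> A" for x
        using that by blast
      have AX: "A \<subseteq> mspace X" using A by auto
      obtain S where S: "S \<subseteq> A" "disjoint_family_on (\<lambda>x. mcball_of X x (r x)) S"
        "A \<subseteq> (\<Union>y\<in>S. mcball_of X y (3 * r y))"
        by (rule Vitali_covering_mcball_of[OF AX r])
      have sums: "(\<Sum>y\<in>F. r y powr s) \<le> C * h" if F: "finite F" "F \<subseteq> S" for F
      proof -
        have "ennreal (\<Sum>y\<in>F. inverse C * r y powr s) = (\<Sum>y\<in>F. ennreal (inverse C * r y powr s))"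
          using C(1) by (intro sum_ennreal[symmetric]) auto
        also have "\<dots> \<le> (\<Sum>y\<in>F. hausdorff_measure X s (mcball_of X y (r y)))"
        proof (intro sum_mono C(2))
          fix y assume "y \<in> F"
          then have y: "y \<in> A" using F S by blast
          show "y \<in> mspace X" "r y > 0" using AX r y by auto
          show "ennreal (r y) \<le> ediam X (mspace X)"
            using r[OF y] \<rho>(3) by (auto intro: order_trans[OF ennreal_leI])
        qed
        also have "\<dots> = hausdorff_measure X s (\<Union>y\<in>F. mcball_of X y (r y))"
          using F S(2) by (intro sum_borel_regular_disjoint[OF br])
            (auto intro: mcball_of_in_borel_sets disjoint_family_on_mono)
        also have "\<dots> \<le> hausdorff_measure X s (mcball_of X p (R + 1))"
        proof (rule hausdorff_measure_mono, safe)
          fix y z assume "y \<in> F" and z: "z \<in> mcball_of X y (r y)"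
          then have y: "y \<in> A" using F S by blast
          have "mdist X p z \<le> mdist X p y + mdist X y z"
            using z p by (intro mdist_triangle) auto
          then show "z \<in> mcball_of X p (R + 1)"
            using z A y r[OF y] \<rho>(2) p by fastforce
        qed
        finally have "(\<Sum>y\<in>F. inverse C * r y powr s) \<le> h"
          using h by simp
        then have "inverse C * (\<Sum>y\<in>F. r y powr s) \<le> h"
          by (simp add: sum_distrib_left)
        then show ?thesis
          using C(1) by (simp add: field_simps)
      qed
      moreover have "countable S"
        by (rule countable_if_bounded_sums[OF _ sums]) (use S(1) r in force)+
      ultimately show "\<exists>S\<subseteq>A. countable S \<and> A \<subseteq> (\<Union>y\<in>S. mcball_of X y (3 * r y)) \<and>
          (\<forall>F. finite F \<longrightarrow> F \<subseteq> S \<longrightarrow> (\<Sum>y\<in>F. r y powr s) \<le> C * h)"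
        using S by blast
    qed
  qed (use C(1) h(2) \<rho>(1) in auto)
qed

section \<open>Lipschitz functions and chart derivatives\<close>

text \<open>
  McShane's extension. It is needed since charts differentiate only functions defined on the whole
  space, whereas the map to be studied is given only on the chart.
\<close>

lemma Lipschitz_extension_real:
  fixes f :: "'a \<Rightarrow> real"
  assumes "U \<subseteq> mspace X" "U \<noteq> {}" "L \<ge> 0"
    and L: "\<And>x y. x \<in> U \<Longrightarrow> y \<in> U \<Longrightarrow> \<bar>f x - f y\<bar> \<le> L * mdist X x y"
  obtains g :: "'a \<Rightarrow> real" where "Lipschitz_continuous_map X euclidean_metric g" "\<And>x. x \<in> U \<Longrightarrow> g x = f x"
proof
  define g where "g x = (INF u\<in>U. f u + L * mdist X u x)" for x
  have bound: "f w - L * mdist X w x \<le> f u + L * mdist X u x"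
    if "w \<in> U" "u \<in> U" "x \<in> mspace X" for w u x
  proof -
    have "mdist X w u \<le> mdist X w x + mdist X u x"
      using that assms(1) mdist_triangle[of w X x u] mdist_commute[of X x u] by auto
    then have "L * mdist X w u \<le> L * mdist X w x + L * mdist X u x"
      using assms(3) by (simp add: mult_left_mono flip: distrib_left)
    then show ?thesis
      using L[OF that(1,2)] by linarith
  qed
  have bdd: "bdd_below ((\<lambda>u. f u + L * mdist X u x) ` U)" if x: "x \<in> mspace X" for x
  proof -
    obtain w where w: "w \<in> U" using assms(2) by blast
    show ?thesis
      by (rule bdd_belowI2[where m = "f w - L * mdist X w x"]) (rule bound[OF w _ x])
  qed
  have le: "g x \<le> g y + L * mdist X x y" if x: "x \<in> mspace X" and y: "y \<in> mspace X" for x y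
  proof -
    have "g x - L * mdist X x y \<le> f u + L * mdist X u y" if u: "u \<in> U" for u
    proof -
      have "mdist X u x \<le> mdist X u y + mdist X x y"
        using u x y assms(1) mdist_triangle[of u X y x] mdist_commute[of X x y] by auto
      then have "L * mdist X u x \<le> L * mdist X u y + L * mdist X x y"
        using assms(3) by (simp add: mult_left_mono flip: distrib_left)
      moreover have "g x \<le> f u + L * mdist X u x"
        unfolding g_def using bdd[OF x] u by (rule cINF_lower)
      ultimately show ?thesis by linarith
    qed
    then have "g x - L * mdist X x y \<le> g y"
      unfolding g_def[of y] by (intro cINF_greatest assms(2))
    then show ?thesis by simp
  qed
  show "Lipschitz_continuous_map X euclidean_metric g"
    unfolding Lipschitz_continuous_map_def
  proof (intro conjI exI[of _ L] ballI)
    fix x y assume "x \<in> mspace X" "y \<in> mspace X"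
    then show "mdist euclidean_metric (g x) (g y) \<le> L * mdist X x y"
      using le[of x y] le[of y x] mdist_commute[of X x y] by (simp add: dist_real_def)
  qed auto
  show "g x = f x" if x: "x \<in> U" for x
  proof (rule antisym)
    have xX: "x \<in> mspace X" and d0: "mdist X x x = 0"
      using x assms(1) by auto
    have "g x \<le> f x + L * mdist X x x"
      unfolding g_def using bdd[OF xX] x by (rule cINF_lower)
    then show "g x \<le> f x"
      unfolding d0 by simp
    have "f x \<le> f u + L * mdist X u x" if "u \<in> U" for u
      using bound[OF x that xX] unfolding d0 by simp
    then show "f x \<le> g x"
      unfolding g_def by (intro cINF_greatest assms(2))
  qed
qed

lemma has_chart_derivative_error_le:
  assumes "has_chart_derivative X U n \<phi> f x v" "x \<in> mspace X" "U \<subseteq> mspace X" "e > 0"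
  obtains d where "d > 0"
    "\<And>y. y \<in> U \<Longrightarrow> mdist X x y < d \<Longrightarrow>
      \<bar>f y - f x - (\<Sum>j<n. v j * (\<phi> y j - \<phi> x j))\<bar> \<le> e * mdist X x y"
proof -
  interpret Metric_space "mspace X" "mdist X" by (rule Metric_space_mspace_mdist)
  let ?E = "\<lambda>y. \<bar>f y - f x - (\<Sum>j<n. v j * (\<phi> y j - \<phi> x j))\<bar>"
  have "\<forall>\<^sub>F y in atin_within mtopology x U. ?E y / mdist X x y < e"
    using assms(1,4) unfolding has_chart_derivative_def mtopology_of_def
    by (rule order_tendstoD(2))
  then obtain d where d: "d > 0"
    "\<And>y. y \<in> mspace X \<Longrightarrow> y \<in> U \<Longrightarrow> 0 < mdist X y x \<Longrightarrow> mdist X y x < d \<Longrightarrow> ?E y / mdist X x y < e"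
    unfolding eventually_atin_within_metric using assms(2) by blast
  show ?thesis
  proof (rule that[OF d(1)])
    fix y assume y: "y \<in> U" "mdist X x y < d"
    have yX: "y \<in> mspace X" using y assms(3) by blast
    show "?E y \<le> e * mdist X x y"
    proof (cases "y = x")
      case False
      then have pos: "0 < mdist X x y"
        using assms(2) yX by simp
      then have "?E y / mdist X x y < e"
        using d(2)[OF yX y(1)] y(2) mdist_commute[of X x y] by simp
      then show ?thesis
        using pos by (simp add: divide_less_eq)
    next
      case True
      then show ?thesis using assms(2) by simp
    qed
  qed
qed

text \<open>
  The heart of the argument. On a set of size \<open>\<rho>\<close> the map \<open>f\<close> is, up to an error \<open>\<rho>/m\<close>, a linear
  function of the \<open>k\<close> coordinates \<open>\<phi>\<close>. The values of \<open>\<phi>\<close> lie in a cube of side \<open>2L\<rho>\<close>, which is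
  divided into at most \<open>(3Lm)\<^sup>k\<close> cells of side \<open>\<rho>/m\<close>, and the image of the points of one cell has
  diameter comparable to \<open>\<rho>/m\<close>. The total is of order \<open>m\<^sup>k\<^sup>-\<^sup>s \<rho>\<^sup>s\<close>, which is small against \<open>\<rho>\<^sup>s\<close>
  for large \<open>m\<close> because \<open>k < s\<close>. Dividing the domain of the linear map, instead of its image,
  avoids all linear algebra, at the price of the bound \<open>M\<close> on its coefficients.
\<close>

lemma hausdorff_content_image_chart_ball_le:
  fixes f \<phi> :: "'a \<Rightarrow> nat \<Rightarrow> real" and m L N k :: nat and s \<delta> \<rho> M :: real
  assumes "s > 0" "m \<ge> 1" "L \<ge> 1" "\<rho> > 0" "\<delta> > 0" "M \<ge> 0"
    and \<phi>: "\<And>y j. y \<in> B \<Longrightarrow> j < k \<Longrightarrow> \<bar>\<phi> y j - \<phi> x j\<bar> \<le> L * \<rho>"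
    and v: "\<And>i j. i < N \<Longrightarrow> j < k \<Longrightarrow> \<bar>v i j\<bar> \<le> M"
    and f: "\<And>y i. y \<in> B \<Longrightarrow> i < N \<Longrightarrow>
      \<bar>f y i - f x i - (\<Sum>j<k. v i j * (\<phi> y j - \<phi> x j))\<bar> \<le> \<rho> / m"
    and fB: "f ` B \<subseteq> mspace (real_space N)"
    and small: "N * (k * M + 2) * \<rho> / m \<le> \<delta>"
  shows "hausdorff_content (real_space N) s \<delta> (f ` B) \<le>
    ennreal ((3 * L * m) ^ k * (N * (k * M + 2) * \<rho> / m) powr s)"
proof -
  define D where "D = N * (k * M + 2) * \<rho> / m"
  have D0: "D \<ge> 0"
    using assms(4,6) by (simp add: D_def)
  define cell where "cell y = (\<lambda>j\<in>{..<k}. \<lfloor>(\<phi> y j - \<phi> x j) * m / \<rho>\<rfloor>)" for y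
  define I where "I = (\<Pi>\<^sub>E j\<in>{..<k}. {- int (L * m)..int (L * m)})"
  have finI: "finite I"
    unfolding I_def by (intro finite_PiE) auto
  have "card {- int (L * m)..int (L * m)} = 2 * (L * m) + 1"
    unfolding card_atLeastAtMost_int by linarith
  then have "card I = (2 * (L * m) + 1) ^ k"
    by (simp add: I_def card_PiE)
  also have "\<dots> \<le> (3 * L * m) ^ k"
    using mult_le_mono[OF assms(3,2)] by (intro power_mono) auto
  finally have cardI: "real (card I) \<le> (3 * L * m) ^ k"
    by (metis of_nat_le_iff of_nat_power)
  have cellI: "cell y \<in> I" if y: "y \<in> B" for y
    unfolding I_def cell_def
  proof (rule restrict_PiE_iff[THEN iffD2], rule ballI)
    fix j assume "j \<in> {..<k}"
    then have "\<bar>\<phi> y j - \<phi> x j\<bar> \<le> L * \<rho>" using \<phi>[OF y] by simp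
    then have "\<bar>\<phi> y j - \<phi> x j\<bar> * (m / \<rho>) \<le> L * \<rho> * (m / \<rho>)"
      using assms(4) by (intro mult_right_mono) auto
    then have "\<bar>(\<phi> y j - \<phi> x j) * m / \<rho>\<bar> \<le> real (L * m)"
      using assms(4) by (simp add: abs_mult)
    then show "\<lfloor>(\<phi> y j - \<phi> x j) * m / \<rho>\<rfloor> \<in> {- int (L * m)..int (L * m)}"
      unfolding atLeastAtMost_iff by linarith
  qed
  have diam: "ediam (real_space N) (f ` {y \<in> B. cell y = c}) \<le> ennreal D" for c
  proof -
    have "L2_set (\<lambda>i. f y i - f z i) {..<N} \<le> D"
      if y: "y \<in> B" and z: "z \<in> B" and eq: "cell y = cell z" for y z
    proof -
      have \<phi>yz: "\<bar>\<phi> y j - \<phi> z j\<bar> \<le> \<rho> / m" if j: "j < k" for j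
      proof -
        have "\<lfloor>(\<phi> y j - \<phi> x j) * m / \<rho>\<rfloor> = \<lfloor>(\<phi> z j - \<phi> x j) * m / \<rho>\<rfloor>"
          using fun_cong[OF eq, of j] j by (simp add: cell_def)
        then have "\<bar>(\<phi> y j - \<phi> x j) * m / \<rho> - (\<phi> z j - \<phi> x j) * m / \<rho>\<bar> \<le> 1"
          by linarith
        also have "(\<phi> y j - \<phi> x j) * m / \<rho> - (\<phi> z j - \<phi> x j) * m / \<rho> = (\<phi> y j - \<phi> z j) * (m / \<rho>)"
          by (simp add: algebra_simps diff_divide_distrib)
        finally have "\<bar>\<phi> y j - \<phi> z j\<bar> * (m / \<rho>) \<le> 1"
          using assms(4) by (simp add: abs_mult)
        then show ?thesis
          using assms(2,4) by (simp add: field_simps)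
      qed
      have "\<bar>f y i - f z i\<bar> \<le> (k * M + 2) * (\<rho> / m)" if i: "i < N" for i
      proof -
        have "\<bar>\<Sum>j<k. v i j * (\<phi> y j - \<phi> z j)\<bar> \<le> (\<Sum>j<k. \<bar>v i j\<bar> * \<bar>\<phi> y j - \<phi> z j\<bar>)"
          using sum_abs[of "\<lambda>j. v i j * (\<phi> y j - \<phi> z j)" "{..<k}"] by (simp add: abs_mult)
        also have "\<dots> \<le> (\<Sum>j<k. M * (\<rho> / m))"
          using \<phi>yz v[OF i] assms(6) by (intro sum_mono mult_mono) auto
        also have "\<dots> = k * M * (\<rho> / m)" by simp
        finally have lin: "\<bar>\<Sum>j<k. v i j * (\<phi> y j - \<phi> z j)\<bar> \<le> k * M * (\<rho> / m)" .
        have "(\<Sum>j<k. v i j * (\<phi> y j - \<phi> z j)) =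
            (\<Sum>j<k. v i j * (\<phi> y j - \<phi> x j)) - (\<Sum>j<k. v i j * (\<phi> z j - \<phi> x j))"
          by (simp add: sum_subtractf[symmetric] algebra_simps)
        moreover have "(k * M + 2) * (\<rho> / m) = k * M * (\<rho> / m) + 2 * (\<rho> / m)"
          by (rule distrib_right)
        ultimately show ?thesis
          using lin f[OF y i] f[OF z i] by linarith
      qed
      then have "(\<Sum>i<N. \<bar>f y i - f z i\<bar>) \<le> (\<Sum>i<N. (k * M + 2) * (\<rho> / m))"
        by (intro sum_mono) auto
      also have "\<dots> = D" by (simp add: D_def)
      finally show ?thesis
        using L2_set_le_sum_abs[of "\<lambda>i. f y i - f z i" "{..<N}"] by linarith
    qed
    then show ?thesis
      by (auto simp: ediam_le_iff intro!: ennreal_leI)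
  qed
  have "f ` B \<subseteq> (\<Union>c\<in>I. f ` {y \<in> B. cell y = c})"
    using cellI by blast
  then have "hausdorff_content (real_space N) s \<delta> (f ` B) \<le>
      hausdorff_content (real_space N) s \<delta> (\<Union>c\<in>I. f ` {y \<in> B. cell y = c})"
    by (rule hausdorff_content_mono)
  also have "\<dots> \<le> ennreal ((3 * L * m) ^ k * D powr s)"
  proof (rule hausdorff_content_UN_le[where w = "\<lambda>_. D powr s"])
    show "hausdorff_content (real_space N) s \<delta> (f ` {y \<in> B. cell y = c}) \<le> ennreal (D powr s)" for c
      using fB diam small[folded D_def] D0
      by (intro hausdorff_content_le_powr assms(1)) auto
    fix F assume "finite F" "F \<subseteq> I"
    then have "real (card F) \<le> (3 * L * m) ^ k"
      using card_mono[OF finI] cardI by (meson of_nat_mono order_trans)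
    then show "(\<Sum>c\<in>F. D powr s) \<le> (3 * L * m) ^ k * D powr s"
      by (simp add: mult_right_mono)
  qed (use assms(1,5) finI in \<open>auto intro: countable_finite\<close>)
  finally show ?thesis
    unfolding D_def .
qed

section \<open>Images of points of linear approximation\<close>

text \<open>
  A common bound \<open>M\<close> on the coefficients makes the estimate on small balls uniform in the centre. The
  radii at which the approximation is good to order \<open>1/m\<close> depend on the centre, so the balls
  are selected by Vitali's theorem; the bound on \<open>\<Sum> r\<^sup>s\<close> turns the local estimates into one of order
  \<open>m\<^sup>k\<^sup>-\<^sup>s\<close> for the whole image, and \<open>m\<close> tends to infinity.
\<close>

lemma hausdorff_measure_image_linear_null:
  fixes X :: "'a metric" and f \<phi> :: "'a \<Rightarrow> nat \<Rightarrow> real" and L N k :: nat and M R s :: real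
  assumes "s > 0" "real k < s" and br: "borel_regular X (hausdorff_measure X s)"
    and ar: "ahlfors_regular X s" and diam: "ediam X (mspace X) \<noteq> 0"
    and p: "p \<in> mspace X" "R > 0" and U: "U \<subseteq> mspace X"
    and A: "A \<subseteq> U \<inter> mcball_of X p R" and "L \<ge> 1" "M \<ge> 0"
    and \<phi>: "\<And>x y j. x \<in> U \<Longrightarrow> y \<in> U \<Longrightarrow> j < k \<Longrightarrow> \<bar>\<phi> y j - \<phi> x j\<bar> \<le> L * mdist X x y"
    and fU: "f ` U \<subseteq> mspace (real_space N)"
    and lin: "\<And>x. x \<in> A \<Longrightarrow> \<exists>v. (\<forall>i<N. \<forall>j<k. \<bar>v i j\<bar> \<le> M) \<and>
      (\<forall>e>0. \<exists>d>0. \<forall>i<N. \<forall>y\<in>U. mdist X x y < d \<longrightarrow>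
        \<bar>f y i - f x i - (\<Sum>j<k. v i j * (\<phi> y j - \<phi> x j))\<bar> \<le> e * mdist X x y)"
  shows "hausdorff_measure (real_space N) s (f ` A) = 0"
proof (rule hausdorff_measure_eq_0I)
  fix \<delta> :: real assume \<delta>: "\<delta> > 0"
  let ?H = "hausdorff_content (real_space N) s \<delta>"
  define c where "c = N * (k * M + 2)"
  have c0: "c \<ge> 0" using \<open>M \<ge> 0\<close> by (simp add: c_def)
  obtain K \<rho> :: real where K: "K \<ge> 0" "\<rho> > 0"
    and Vitali: "\<forall>A r. A \<subseteq> mcball_of X p R \<longrightarrow> (\<forall>x\<in>A. 0 < r x \<and> r x \<le> \<rho>) \<longrightarrow>
      (\<exists>S\<subseteq>A. countable S \<and> A \<subseteq> (\<Union>y\<in>S. mcball_of X y (3 * r y)) \<and>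
        (\<forall>F. finite F \<longrightarrow> F \<subseteq> S \<longrightarrow> (\<Sum>y\<in>F. r y powr s) \<le> K))"
    by (rule ahlfors_regular_Vitali[OF br ar diam p])
  \<comment> \<open>The constant collects everything in the local estimate that depends neither on \<open>m\<close> nor on the ball.\<close>
  define C where "C = (3 * L) ^ k * (3 * c) powr s"
  have C0: "C \<ge> 0" by (simp add: C_def)
  have "\<forall>x\<in>A. \<exists>v. (\<forall>i<N. \<forall>j<k. \<bar>v i j\<bar> \<le> M) \<and>
      (\<forall>e>0. \<exists>d>0. \<forall>i<N. \<forall>y\<in>U. mdist X x y < d \<longrightarrow>
        \<bar>f y i - f x i - (\<Sum>j<k. v i j * (\<phi> y j - \<phi> x j))\<bar> \<le> e * mdist X x y)"
    using lin by (rule ballI)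
  then obtain v where vlin: "\<forall>x\<in>A. (\<forall>i<N. \<forall>j<k. \<bar>v x i j\<bar> \<le> M) \<and>
      (\<forall>e>0. \<exists>d>0. \<forall>i<N. \<forall>y\<in>U. mdist X x y < d \<longrightarrow>
        \<bar>f y i - f x i - (\<Sum>j<k. v x i j * (\<phi> y j - \<phi> x j))\<bar> \<le> e * mdist X x y)"
    by (rule bchoice[THEN exE])
  have v: "\<bar>v x i j\<bar> \<le> M" if "x \<in> A" "i < N" "j < k" for x i j
    using bspec[OF vlin that(1), THEN conjunct1] that(2,3) by simp
  have bound: "?H (f ` A) \<le> ennreal (C * K * real m powr (k - s))" if m: "m \<ge> 1" for m :: nat
  proof -
    have "1 / real m > 0" using m by simp
    have "\<exists>d>0. \<forall>i<N. \<forall>y\<in>U. mdist X x y < d \<longrightarrow>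
        \<bar>f y i - f x i - (\<Sum>j<k. v x i j * (\<phi> y j - \<phi> x j))\<bar> \<le> 1 / m * mdist X x y"
      if "x \<in> A" for x
      using bspec[OF vlin that, THEN conjunct2, rule_format, OF \<open>1 / real m > 0\<close>] .
    then have "\<forall>x\<in>A. \<exists>d>0. \<forall>i<N. \<forall>y\<in>U. mdist X x y < d \<longrightarrow>
        \<bar>f y i - f x i - (\<Sum>j<k. v x i j * (\<phi> y j - \<phi> x j))\<bar> \<le> 1 / m * mdist X x y"
      by (rule ballI)
    then obtain d where dlin: "\<forall>x\<in>A. d x > 0 \<and> (\<forall>i<N. \<forall>y\<in>U. mdist X x y < d x \<longrightarrow>
        \<bar>f y i - f x i - (\<Sum>j<k. v x i j * (\<phi> y j - \<phi> x j))\<bar> \<le> 1 / m * mdist X x y)"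
      by (rule bchoice[THEN exE])
    have d: "d x > 0" if "x \<in> A" for x
      using dlin that by blast
    have err: "\<bar>f y i - f x i - (\<Sum>j<k. v x i j * (\<phi> y j - \<phi> x j))\<bar> \<le> 1 / m * mdist X x y"
      if "x \<in> A" "i < N" "y \<in> U" "mdist X x y < d x" for x i y
      using bspec[OF dlin that(1), THEN conjunct2, rule_format, OF that(2-4)] .
    \<comment> \<open>\<open>3 * r x < d x\<close> keeps the tripled ball in the range of the approximation, and the last term keeps the covering sets below \<open>\<delta>\<close>; the 1 prevents division by 0 when \<open>N = 0\<close>.\<close>
    define r where "r x = min \<rho> (min (d x / 4) (\<delta> / (3 * (c + 1))))" for x
    have r: "0 < r x \<and> r x \<le> \<rho>" "3 * r x < d x" "c * (3 * r x) / m \<le> \<delta>" if x: "x \<in> A" for x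
    proof -
      show r0: "0 < r x \<and> r x \<le> \<rho>"
        using K d[OF x] \<delta> c0 by (simp add: r_def)
      show "3 * r x < d x"
        using d[OF x] by (simp add: r_def min_def)
      have "r x \<le> \<delta> / (3 * (c + 1))"
        by (simp add: r_def)
      then have "r x * (3 * (c + 1)) \<le> \<delta>"
        using c0 by (simp add: pos_le_divide_eq)
      then have "c * (3 * r x) \<le> \<delta>"
        using r0 by (simp add: algebra_simps)
      moreover have "c * (3 * r x) / m \<le> c * (3 * r x)"
        using divide_left_mono[of 1 "real m" "c * (3 * r x)"] m c0 r0 by simp
      ultimately show "c * (3 * r x) / m \<le> \<delta>" by simp
    qed
    obtain S where S: "S \<subseteq> A" "countable S" "A \<subseteq> (\<Union>y\<in>S. mcball_of X y (3 * r y))"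
      and sums: "\<And>F. finite F \<Longrightarrow> F \<subseteq> S \<Longrightarrow> (\<Sum>y\<in>F. r y powr s) \<le> K"
      using spec[OF spec[OF Vitali], of A r] A r(1) by auto
    define B where "B x = U \<inter> mcball_of X x (3 * r x)" for x
    have ball: "?H (f ` B x) \<le> ennreal (C * real m powr (k - s) * r x powr s)" if x: "x \<in> A" for x
    proof -
      have xU: "x \<in> U" using A x by blast
      have "?H (f ` B x) \<le> ennreal ((3 * L * m) ^ k * (N * (k * M + 2) * (3 * r x) / m) powr s)"
      proof (rule hausdorff_content_image_chart_ball_le[where v = "v x" and x = x])
        show "\<bar>\<phi> y j - \<phi> x j\<bar> \<le> L * (3 * r x)" if "y \<in> B x" "j < k" for y j
        proof -
          have "y \<in> U" "mdist X x y \<le> 3 * r x" using that by (auto simp: B_def)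
          then show ?thesis
            using \<phi>[OF xU \<open>y \<in> U\<close> that(2)] mult_left_mono[of "mdist X x y" "3 * r x" L]
            by simp
        qed
        show "\<bar>f y i - f x i - (\<Sum>j<k. v x i j * (\<phi> y j - \<phi> x j))\<bar> \<le> 3 * r x / m"
          if "y \<in> B x" "i < N" for y i
        proof -
          have y: "y \<in> U" "mdist X x y \<le> 3 * r x" using that by (auto simp: B_def)
          have "1 / m * mdist X x y \<le> 1 / m * (3 * r x)"
            using y(2) by (intro mult_left_mono) auto
          then show ?thesis
            using err[OF x that(2) y(1)] y(2) r(2)[OF x] by simp
        qed
        show "f ` B x \<subseteq> mspace (real_space N)"
          using fU by (auto simp: B_def)
        show "N * (k * M + 2) * (3 * r x) / m \<le> \<delta>"
          using r(3)[OF x] by (simp add: c_def)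
      qed (use assms(1) m \<open>L \<ge> 1\<close> \<open>M \<ge> 0\<close> \<delta> r(1)[OF x] v[OF x] in auto)
      also have "(3 * L * m) ^ k * (N * (k * M + 2) * (3 * r x) / m) powr s =
          C * real m powr (k - s) * r x powr s"
      proof -
        have "real ((3 * L * m) ^ k) = (3 * L) ^ k * real m powr k"
          using m by (simp add: powr_realpow power_mult_distrib)
        moreover have "N * (k * M + 2) * (3 * r x) / m = 3 * c * r x / m"
          unfolding c_def by (simp only: mult_ac)
        then have "(N * (k * M + 2) * (3 * r x) / m) powr s =
            (3 * c) powr s * r x powr s / real m powr s"
          by (simp only: powr_divide powr_mult)
        ultimately show ?thesis
          by (simp add: C_def powr_diff)
      qed
      finally show ?thesis .
    qed
    have "f ` A \<subseteq> (\<Union>x\<in>S. f ` B x)"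
      using S(3) A by (fastforce simp: B_def)
    then have "?H (f ` A) \<le> ?H (\<Union>x\<in>S. f ` B x)"
      by (rule hausdorff_content_mono)
    also have "\<dots> \<le> ennreal (C * K * real m powr (k - s))"
    proof (rule hausdorff_content_UN_le[OF assms(1) \<delta> S(2)])
      show "?H (f ` B x) \<le> ennreal (C * real m powr (k - s) * r x powr s)" if "x \<in> S" for x
        using ball that S(1) by blast
      fix F assume "finite F" "F \<subseteq> S"
      then have "C * real m powr (k - s) * (\<Sum>x\<in>F. r x powr s) \<le> C * real m powr (k - s) * K"
        using C0 by (intro mult_left_mono sums) auto
      then show "(\<Sum>x\<in>F. C * real m powr (k - s) * r x powr s) \<le> C * K * real m powr (k - s)"
        by (simp only: sum_distrib_left[symmetric]) (simp add: mult_ac)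
    qed (use C0 in auto)
    finally show ?thesis .
  qed
  have "(\<lambda>m. real m powr (k - s)) \<longlonglongrightarrow> 0"
    using assms(2) by (intro tendsto_neg_powr filterlim_real_sequentially) auto
  then have "(\<lambda>m. C * K * real m powr (k - s)) \<longlonglongrightarrow> C * K * 0"
    by (rule tendsto_mult_left)
  then have "(\<lambda>m. ennreal (C * K * real m powr (k - s))) \<longlonglongrightarrow> ennreal (C * K * 0)"
    by (rule tendsto_ennrealI)
  then have "?H (f ` A) \<le> ennreal (C * K * 0)"
    by (rule LIMSEQ_le_const) (use bound in blast)
  then show "?H (f ` A) = 0" by simp
qed

section \<open>Unrectifiability of charts\<close>

lemma abs_le_L2_set:
  fixes n :: nat
  assumes "i < n"
  shows "\<bar>a i\<bar> \<le> L2_set a {..<n}"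
proof -
  have "\<bar>a i\<bar> \<le> L2_set (\<lambda>i. \<bar>a i\<bar>) {..<n}"
    by (rule member_le_L2_set) (use assms in auto)
  then show ?thesis
    by (simp add: L2_set_def)
qed

theorem theorem1p4:
  fixes X :: "'a metric" and s :: real and U :: "'a set" and k :: nat
    and \<phi> :: "'a \<Rightarrow> nat \<Rightarrow> real"
  assumes "s > 0"
    and "ahlfors_regular X s"
    and "lipschitz_differentiability_space X (hausdorff_measure X s)"
    and "lipschitz_chart X (hausdorff_measure X s) U k \<phi>"
    and "real k < s"
  shows "strongly_unrectifiable X s U"
  unfolding strongly_unrectifiable_def
proof (intro allI impI)
  fix N and f :: "'a \<Rightarrow> nat \<Rightarrow> real"
  assume f: "Lipschitz_continuous_map (submetric X U) (real_space N) f"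
  let ?\<mu> = "hausdorff_measure X s"
  have br: "borel_regular X ?\<mu>"
    using assms(3) by (simp add: lipschitz_differentiability_space_def)
  have chart: "U \<in> caratheodory_sets X ?\<mu>" "?\<mu> U > 0"
    "Lipschitz_continuous_map (submetric X U) (real_space k) \<phi>"
    and ae: "\<And>g :: 'a \<Rightarrow> real. Lipschitz_continuous_map X euclidean_metric g \<Longrightarrow>
       ?\<mu> {x \<in> U. \<not> (\<exists>!v. v \<in> mspace (real_space k) \<and> has_chart_derivative X U k \<phi> g x v)} = 0"
    using assms(4) by (auto simp: lipschitz_chart_def)
  have U: "U \<subseteq> mspace X"
    using chart(1) by (auto simp: caratheodory_sets_def lambda_system_def)
  then have mU: "mspace (submetric X U) = U"
    by auto
  have diam: "ediam X (mspace X) \<noteq> 0"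
  proof
    assume "ediam X (mspace X) = 0"
    then have "?\<mu> (mspace X) = 0"
      by (intro hausdorff_measure_ediam_0 assms(1)) auto
    then show False
      using chart(2) hausdorff_measure_mono[OF U, of X s] by simp
  qed
  have "?\<mu> {} = 0"
    by (rule hausdorff_measure_ediam_0) (use assms(1) in \<open>auto simp: ediam_def bot_ennreal\<close>)
  then obtain p where p: "p \<in> U"
    using chart(2) by fastforce
  obtain L\<phi> where L\<phi>: "\<forall>x\<in>U. \<forall>y\<in>U. mdist (real_space k) (\<phi> x) (\<phi> y) \<le> L\<phi> * mdist X x y"
    using chart(3) mU unfolding Lipschitz_continuous_map_def by auto
  obtain Lf where Lf: "Lf > 0" "\<forall>x\<in>U. \<forall>y\<in>U. mdist (real_space N) (f x) (f y) \<le> Lf * mdist X x y"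
    and fU: "f ` U \<subseteq> mspace (real_space N)"
    using f mU unfolding Lipschitz_continuous_map_pos by auto
  \<comment> \<open>An upper bound of the Lipschitz constant that is a positive natural number, as it counts cells.\<close>
  define L where "L = nat \<lceil>\<bar>L\<phi>\<bar>\<rceil> + 1"
  have L: "\<bar>\<phi> y j - \<phi> x j\<bar> \<le> L * mdist X x y" if "x \<in> U" "y \<in> U" "j < k" for x y j
  proof -
    have "\<bar>\<phi> y j - \<phi> x j\<bar> \<le> L\<phi> * mdist X y x"
      using L\<phi> that abs_le_L2_set[OF that(3), of "\<lambda>j. \<phi> y j - \<phi> x j"] by fastforce
    also have "\<dots> \<le> L * mdist X x y"
      unfolding mdist_commute[of X y x] L_def by (intro mult_right_mono mdist_nonneg) linarith
    finally show ?thesis .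
  qed
  have "\<exists>g :: 'a \<Rightarrow> real. Lipschitz_continuous_map X euclidean_metric g \<and> (\<forall>x\<in>U. g x = f x i)"
    if i: "i < N" for i
  proof -
    have "\<bar>f x i - f y i\<bar> \<le> Lf * mdist X x y" if "x \<in> U" "y \<in> U" for x y
      using Lf(2) that abs_le_L2_set[OF i, of "\<lambda>j. f x j - f y j"] by fastforce
    then show ?thesis
      using Lipschitz_extension_real[of U X Lf "\<lambda>x. f x i"] U p Lf(1) by (metis empty_iff less_imp_le)
  qed
  then obtain g :: "nat \<Rightarrow> 'a \<Rightarrow> real"
    where g: "\<And>i. i < N \<Longrightarrow> Lipschitz_continuous_map X euclidean_metric (g i)"
      and gf: "\<And>i x. i < N \<Longrightarrow> x \<in> U \<Longrightarrow> g i x = f x i"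
    by metis
  \<comment> \<open>Points where the extension of some coordinate of \<open>f\<close> has no unique chart derivative form a null set, and so does their image.\<close>
  define Z where "Z i = (if i < N then {x \<in> U. \<not> (\<exists>!v. v \<in> mspace (real_space k) \<and>
    has_chart_derivative X U k \<phi> (g i) x v)} else {})" for i
  have "hausdorff_measure (real_space N) s (f ` Z i) = 0" for i
  proof (rule hausdorff_measure_Lipschitz_image_null[OF assms(1) f])
    show "?\<mu> (Z i) = 0"
      using ae[OF g] \<open>?\<mu> {} = 0\<close> by (simp add: Z_def)
  qed (use U in \<open>auto simp: Z_def\<close>)
  then have Z0: "hausdorff_measure (real_space N) s (\<Union>i. f ` Z i) = 0"
    by (rule hausdorff_measure_UN_null)
  define lin where "lin x v \<longleftrightarrow> (\<forall>e>0. \<exists>d>0. \<forall>i<N. \<forall>y\<in>U. mdist X x y < d \<longrightarrow>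
    \<bar>f y i - f x i - (\<Sum>j<k. v i j * (\<phi> y j - \<phi> x j))\<bar> \<le> e * mdist X x y)"
    for x and v :: "nat \<Rightarrow> nat \<Rightarrow> real"
  \<comment> \<open>The remaining points, exhausted by bounded sets on which the derivatives are bounded.\<close>
  define A where "A n = {x \<in> U \<inter> mcball_of X p (Suc n).
    \<exists>v. (\<forall>i<N. \<forall>j<k. \<bar>v i j\<bar> \<le> real n) \<and> lin x v}" for n
  have "hausdorff_measure (real_space N) s (f ` A n) = 0" for n
  proof (rule hausdorff_measure_image_linear_null[where R = "Suc n" and M = n])
    show "\<exists>v. (\<forall>i<N. \<forall>j<k. \<bar>v i j\<bar> \<le> real n) \<and>
      (\<forall>e>0. \<exists>d>0. \<forall>i<N. \<forall>y\<in>U. mdist X x y < d \<longrightarrow>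
        \<bar>f y i - f x i - (\<Sum>j<k. v i j * (\<phi> y j - \<phi> x j))\<bar> \<le> e * mdist X x y)"
      if "x \<in> A n" for x
      using that unfolding A_def lin_def by blast
    show "A n \<subseteq> U \<inter> mcball_of X p (Suc n)"
      unfolding A_def by blast
    show "p \<in> mspace X" using p U by blast
    show "L \<ge> 1" by (simp add: L_def)
  qed (use assms br diam U fU L in auto)
  then have A0: "hausdorff_measure (real_space N) s (\<Union>n. f ` A n) = 0"
    by (rule hausdorff_measure_UN_null)
  have cover: "x \<in> (\<Union>n. A n)" if x: "x \<in> U" and xZ: "x \<notin> (\<Union>i. Z i)" for x
  proof -
    have "\<exists>v. has_chart_derivative X U k \<phi> (g i) x v" if "i < N" for i
    proof -
      have "x \<notin> Z i" using xZ by blast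
      then show ?thesis using that x by (auto simp: Z_def)
    qed
    then obtain v where v: "\<And>i. i < N \<Longrightarrow> has_chart_derivative X U k \<phi> (g i) x (v i)"
      by metis
    have "lin x v"
      unfolding lin_def
    proof (intro allI impI)
      fix e :: real assume e: "e > 0"
      have "\<exists>d>0. \<forall>y\<in>U. mdist X x y < d \<longrightarrow>
          \<bar>f y i - f x i - (\<Sum>j<k. v i j * (\<phi> y j - \<phi> x j))\<bar> \<le> e * mdist X x y"
        if i: "i < N" for i
      proof -
        obtain d where "d > 0" "\<And>y. y \<in> U \<Longrightarrow> mdist X x y < d \<Longrightarrow>
            \<bar>g i y - g i x - (\<Sum>j<k. v i j * (\<phi> y j - \<phi> x j))\<bar> \<le> e * mdist X x y"
          using has_chart_derivative_error_le[OF v[OF i] _ U e] x U by blast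
        then show ?thesis
          using gf[OF i] x by (intro exI[of _ d]) auto
      qed
      then obtain d where d: "\<And>i. i < N \<Longrightarrow> d i > 0"
        "\<And>i y. i < N \<Longrightarrow> y \<in> U \<Longrightarrow> mdist X x y < d i \<Longrightarrow>
          \<bar>f y i - f x i - (\<Sum>j<k. v i j * (\<phi> y j - \<phi> x j))\<bar> \<le> e * mdist X x y"
        by metis
      \<comment> \<open>The element 1 makes the minimum defined when \<open>N = 0\<close>.\<close>
      let ?d = "Min (insert 1 (d ` {..<N}))"
      have "?d > 0" using d(1) by (auto simp: Min_gr_iff)
      moreover have "?d \<le> d i" if "i < N" for i
        using that by (intro Min_le) auto
      ultimately show "\<exists>d>0. \<forall>i<N. \<forall>y\<in>U. mdist X x y < d \<longrightarrow>
          \<bar>f y i - f x i - (\<Sum>j<k. v i j * (\<phi> y j - \<phi> x j))\<bar> \<le> e * mdist X x y"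
        using d(2) by (intro exI[of _ ?d]) (meson order_less_le_trans)
    qed
    define t where "t = (\<Sum>i<N. \<Sum>j<k. \<bar>v i j\<bar>)"
    have vt: "\<bar>v i j\<bar> \<le> t" if "i < N" "j < k" for i j
    proof -
      have "\<bar>v i j\<bar> \<le> (\<Sum>j<k. \<bar>v i j\<bar>)"
        using that by (intro member_le_sum) auto
      also have "\<dots> \<le> t"
        unfolding t_def using that by (intro member_le_sum[where f = "\<lambda>i. \<Sum>j<k. \<bar>v i j\<bar>"] sum_nonneg) auto
      finally show ?thesis .
    qed
    obtain n :: nat where n: "max t (mdist X p x) \<le> real n"
      using real_arch_simple by blast
    have "x \<in> A n"
      unfolding A_def
    proof (intro CollectI conjI IntI exI[of _ v] allI impI)
      show "x \<in> mcball_of X p (real (Suc n))"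
        using n x p U by auto
      show "\<bar>v i j\<bar> \<le> real n" if "i < N" "j < k" for i j
        using vt[OF that] n by simp
    qed (use x \<open>lin x v\<close> in auto)
    then show ?thesis by blast
  qed
  have "f ` U \<subseteq> (\<Union>i. f ` Z i) \<union> (\<Union>n. f ` A n)"
  proof (rule image_subsetI)
    fix x assume "x \<in> U"
    then consider i where "x \<in> Z i" | n where "x \<in> A n"
      using cover[of x] by blast
    then show "f x \<in> (\<Union>i. f ` Z i) \<union> (\<Union>n. f ` A n)"
      by cases blast+
  qed
  then have "hausdorff_measure (real_space N) s (f ` U) \<le>
      hausdorff_measure (real_space N) s ((\<Union>i. f ` Z i) \<union> (\<Union>n. f ` A n))"
    by (rule hausdorff_measure_mono)
  also have "\<dots> = 0"
    by (rule hausdorff_measure_Un_null[OF Z0 A0])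
  finally show "hausdorff_measure (real_space N) s (f ` U) = 0"
    by simp
qed

end
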